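(* Let $\widehat{\xi}_1,\ldots,\widehat{\xi}_T\in\Xi$ be observations and $\lambda\ge 0$. For any feasible solution $(\mathbb{P}_1,\ldots,\mathbb{P}_T)$ to problem (WPF) given in the context, there exists a feasible solution consisting of discrete distributions supported only on points within the set of observations $\{\widehat{\xi}_1,\ldots,\widehat{\xi}_T\}$ with either the same or an improved (i.e. greater) objective value.
   Context: $\Xi$ is a closed subset of $\mathbb{R}^m$ and $d$ is a metric on $\Xi$ such that $(\Xi,d)$ is a Polish metric space and $d$ is lower semicontinuous. $\mathfrak{P}(\Xi)$ is the set of Borel probability measures on $\Xi$. The Wasserstein distance between $\mathbb{P},\mathbb{Q}\in\mathfrak{P}(\Xi)$ is $$W(\mathbb{P},\mathbb{Q}):=\inf_{\gamma\in\Gamma(\mathbb{P},\mathbb{Q})}\int_{\Xi\times\Xi}d(\xi,\zeta)\,d\gamma(\xi,\zeta),$$ where $\Gamma(\mathbb{P},\mathbb{Q})$ is the set of probability distributions on $\Xi\times\Xi$ with first marginal $\mathbb{P}$ and second marginal $\mathbb{Q}$. Convention: $\log(0):=-\infty$. Problem (WPF): $$\text{maximize over } \mathbb{P}_1,\ldots,\mathbb{P}_T\in\mathfrak{P}(\Xi):\quad\sum_{t=1}^{T}\log\bigl(\mathbb{P}_t(\{\widehat{\xi}_t\})\bigr)-\lambda\sum_{t=1}^{T-1}W(\mathbb{P}_t,\mathbb{P}_{t+1}).$$ *)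

theory Defs
  imports "HOL-Probability.Probability"
begin

definition lower_semicontinuous_on ::
  "'a::topological_space set \<Rightarrow> ('a \<Rightarrow> real) \<Rightarrow> bool"
  where "lower_semicontinuous_on S f \<longleftrightarrow>
    (\<forall>x\<in>S. \<forall>a. a < f x \<longrightarrow> (\<forall>\<^sub>F y in at x within S. a < f y))"

(* The topology of the ambient type plays no role here: completeness and separability
   are those of the metric d itself. *)
definition polish_metric :: "'a set \<Rightarrow> ('a \<Rightarrow> 'a \<Rightarrow> real) \<Rightarrow> bool"
  where "polish_metric X d \<longleftrightarrow>
    Metric_space X d \<and> Metric_space.mcomplete X d \<and>
    separable_space (Metric_space.mtopology X d)"

abbreviation borel_on :: "'a::topological_space set \<Rightarrow> 'a measure"
  where "borel_on X \<equiv> restrict_space borel X"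

abbreviation borel_probs :: "'a::topological_space set \<Rightarrow> 'a measure set"
  where "borel_probs X \<equiv> space (prob_algebra (borel_on X))"

definition couplings ::
  "'a::topological_space set \<Rightarrow> 'a measure \<Rightarrow> 'a measure \<Rightarrow> ('a \<times> 'a) measure set"
  where "couplings X P Q =
    {\<gamma> \<in> space (prob_algebra (borel_on X \<Otimes>\<^sub>M borel_on X)).
       distr \<gamma> (borel_on X) fst = P \<and> distr \<gamma> (borel_on X) snd = Q}"

(* Valued in [0, \<infinity>], since no moment condition is imposed on P and Q. *)
definition wasserstein ::
  "'a::topological_space set \<Rightarrow> ('a \<Rightarrow> 'a \<Rightarrow> real) \<Rightarrow> 'a measure \<Rightarrow> 'a measure \<Rightarrow> ennreal"
  where "wasserstein X d P Q =
    (INF \<gamma>\<in>couplings X P Q. \<integral>\<^sup>+ (x, y). ennreal (d x y) \<partial>\<gamma>)"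

definition elog :: "real \<Rightarrow> ereal"
  where "elog p = (if p = 0 then - \<infinity> else ereal (ln p))"

definition wpf_feasible ::
  "'a::topological_space set \<Rightarrow> nat \<Rightarrow> (nat \<Rightarrow> 'a measure) \<Rightarrow> bool"
  where "wpf_feasible X T P \<longleftrightarrow> (\<forall>t\<in>{1..T}. P t \<in> borel_probs X)"

(* Every logarithm is at most 0 and every Wasserstein distance at least 0, so \<infinity> - \<infinity>
   never occurs for lam \<ge> 0. For lam = 0 the penalty vanishes even if some distance is
   infinite, because 0 * \<infinity> = 0 in ereal. *)
definition wpf_objective ::
  "'a::topological_space set \<Rightarrow> ('a \<Rightarrow> 'a \<Rightarrow> real) \<Rightarrow> real \<Rightarrow> nat \<Rightarrow> (nat \<Rightarrow> 'a)
    \<Rightarrow> (nat \<Rightarrow> 'a measure) \<Rightarrow> ereal"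
  where "wpf_objective X d lam T obs P =
    (\<Sum>t\<in>{1..T}. elog (measure (P t) {obs t}))
    - ereal lam * (\<Sum>t\<in>{1..<T}. enn2ereal (wasserstein X d (P t) (P (Suc t))))"

(* Q is a finite weighted sum of Dirac measures at points of A; the weights add up to 1
   because Q is a probability measure. *)
definition discrete_supported_on ::
  "'a::topological_space set \<Rightarrow> 'a set \<Rightarrow> 'a measure \<Rightarrow> bool"
  where "discrete_supported_on X A Q \<longleftrightarrow>
    Q \<in> borel_probs X \<and> finite A \<and> A \<subseteq> X \<and>
    (\<exists>w :: 'a \<Rightarrow> ennreal. \<forall>B\<in>sets (borel_on X).
       emeasure Q B = (\<Sum>x\<in>A. w x * emeasure (return (borel_on X) x) B))"

end

theory Submission
  imports Defs
begin

text \<open>Linear programming duality replaces both the gluing of couplings and the existence of optimal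
  ones. Weights on the finitely many paths through the observations must give the \<open>t\<close>-th
  observation mass at least \<open>P\<^sub>t({obs t})\<close> at time \<open>t\<close> and have expected length at most the total
  Wasserstein cost of \<open>P\<close>. By a minimax theorem they exist if for all multipliers
  \<open>\<alpha>\<^sub>t, \<beta> \<ge> 0\<close> some path through observations has reward \<open>\<Sum> \<alpha>\<^sub>t [y\<^sub>t = obs t]\<close> minus \<open>\<beta>\<close>
  times length at least \<open>\<Sum> \<alpha>\<^sub>t P\<^sub>t({obs t}) - \<beta> \<Sum> W(P\<^sub>t, P\<^sub>t\<^sub>+\<^sub>1)\<close>.
  The optimal values \<open>V\<^sub>t\<close> of this path problem satisfy
  \<open>V\<^sub>t(x) - (V\<^sub>t\<^sub>+\<^sub>1(y) - \<alpha>\<^sub>t\<^sub>+\<^sub>1 [y = obs (t+1)]) \<le> \<beta> d(x, y)\<close> on the whole space, by the triangle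
  inequality; integrating this against couplings of \<open>P\<^sub>t\<close> and \<open>P\<^sub>t\<^sub>+\<^sub>1\<close> and summing gives the
  bound.\<close>

section \<open>A minimax theorem for finite systems of linear inequalities\<close>

text \<open>Takes the place of a derivative of the squared positive part: as a function of
  \<open>u\<close>, the right side is a quadratic that lies above the left side and agrees with it
  at \<open>u = 0\<close>.\<close>

lemma pos_part_diff_square_le:
  fixes r u :: real
  shows "(max 0 (r - u))\<^sup>2 \<le> (max 0 r - u)\<^sup>2"
proof (cases "r - u > 0")
  case True
  then show ?thesis by (intro power_mono) auto
qed auto

text \<open>The limit of \<open>s\<close> to 0 in elementary form. It yields the first-order
  condition at a minimiser and removes the slack of a nearly optimal coupling.\<close>

lemma nonpos_if_le_small_multiples:
  fixes p q :: real
  assumes "\<And>s. 0 < s \<Longrightarrow> s \<le> 1 \<Longrightarrow> p \<le> s * q"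
  shows "p \<le> 0"
proof (rule ccontr)
  assume "\<not> p \<le> 0"
  \<comment> \<open>This choice gives \<open>s * q \<le> p / 2\<close>; adding 1 keeps the
    denominator positive.\<close>
  define s where "s = min 1 (p / (2 * (\<bar>q\<bar> + 1)))"
  have s: "0 < s" "s \<le> 1" using \<open>\<not> p \<le> 0\<close> by (auto simp: s_def)
  have "s * q \<le> s * (\<bar>q\<bar> + 1)" using s by (intro mult_left_mono) auto
  also have "\<dots> \<le> p / (2 * (\<bar>q\<bar> + 1)) * (\<bar>q\<bar> + 1)"
    by (intro mult_right_mono) (auto simp: s_def)
  also have "\<dots> = p / 2"
    by (simp add: field_simps)
  finally show False using assms[OF s] \<open>\<not> p \<le> 0\<close> by simp
qed

text \<open>Weights are functions on a whole type, so they are pinned to 0 off \<open>Y\<close>: the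
  set is then the intersection of a product of compact sets with a closed set, and Tychonoff's
  theorem applies.\<close>

lemma compact_simplex_weights:
  fixes Y :: "'y set"
  assumes "finite Y"
  shows "compact {w :: 'y \<Rightarrow> real. (\<forall>y\<in>Y. 0 \<le> w y) \<and> (\<forall>y. y \<notin> Y \<longrightarrow> w y = 0) \<and> sum w Y = 1}"
    (is "compact ?K")
proof -
  let ?B = "\<lambda>y. if y \<in> Y then {0..1::real} else {0}"
  have "compactin (product_topology (\<lambda>_. euclidean) UNIV) (PiE UNIV ?B)"
    by (subst compactin_PiE) (auto simp: compactin_euclidean_iff)
  then have "compact (PiE UNIV ?B)"
    by (simp add: euclidean_product_topology)
  moreover have "closed {w :: 'y \<Rightarrow> real. sum w Y = 1}"
    by (intro closed_Collect_eq continuous_intros continuous_on_product_coordinates)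
  moreover have "?K = PiE UNIV ?B \<inter> {w. sum w Y = 1}"
  proof (intro set_eqI iffI)
    fix w assume w: "w \<in> ?K"
    have "w y \<le> 1" if "y \<in> Y" for y
      using w that member_le_sum[of y Y w] assms by auto
    with w show "w \<in> PiE UNIV ?B \<inter> {w. sum w Y = 1}"
      by (auto simp: PiE_iff)
  next
    fix w assume "w \<in> PiE UNIV ?B \<inter> {w. sum w Y = 1}"
    then show "w \<in> ?K" by (auto simp: PiE_iff split: if_splits)
  qed
  ultimately show ?thesis
    by (simp add: compact_Int_closed)
qed

text \<open>The weights minimise the sum of the squared positive parts of the residuals; at a minimiser
  these positive parts, used as multipliers, are forced to vanish by the first-order condition.\<close>

lemma finite_minimax:
  fixes a :: "'y \<Rightarrow> 'i \<Rightarrow> real" and b :: "'i \<Rightarrow> real"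
  assumes "finite Y" "finite I"
    and alt: "\<And>\<alpha>. (\<And>i. 0 \<le> \<alpha> i) \<Longrightarrow> \<exists>y\<in>Y. (\<Sum>i\<in>I. \<alpha> i * b i) \<le> (\<Sum>i\<in>I. \<alpha> i * a y i)"
  obtains w where "\<And>y. y \<in> Y \<Longrightarrow> 0 \<le> w y" "sum w Y = 1"
    "\<And>i. i \<in> I \<Longrightarrow> b i \<le> (\<Sum>y\<in>Y. w y * a y i)"
proof -
  define A where "A w i = (\<Sum>y\<in>Y. w y * a y i)" for w i
  define res where "res w i = max 0 (b i - A w i)" for w i
  define g where "g w = (\<Sum>i\<in>I. (res w i)\<^sup>2)" for w
  define K where "K = {w. (\<forall>y\<in>Y. 0 \<le> w y) \<and> (\<forall>y. y \<notin> Y \<longrightarrow> w y = 0) \<and> sum w Y = (1::real)}"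
  have "compact K"
    unfolding K_def by (rule compact_simplex_weights) fact
  \<comment> \<open>Zero multipliers make \<open>alt\<close> assert just that \<open>Y\<close> is
    nonempty, so that \<open>K\<close> is nonempty too.\<close>
  obtain y0 where "y0 \<in> Y" using alt[of "\<lambda>_. 0"] by auto
  then have "(\<lambda>y. if y = y0 then 1 else 0) \<in> K"
    using \<open>finite Y\<close> by (auto simp: K_def)
  moreover have "continuous_on K g"
    unfolding g_def res_def A_def
    by (intro continuous_intros continuous_on_subset[OF continuous_on_product_coordinates]) auto
  ultimately obtain w where "w \<in> K" and min: "\<And>v. v \<in> K \<Longrightarrow> g w \<le> g v"
    using continuous_attains_inf[OF \<open>compact K\<close>, of g] by blast
  have first_order: "(\<Sum>i\<in>I. res w i * (a y i - A w i)) \<le> 0" if "y \<in> Y" for y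
  proof -
    have "2 * (\<Sum>i\<in>I. res w i * (a y i - A w i)) \<le> s * (\<Sum>i\<in>I. (a y i - A w i)\<^sup>2)"
      if "0 < s" "s \<le> 1" for s
    proof -
      \<comment> \<open>A step of size \<open>s\<close> from \<open>w\<close> towards the unit mass
        at \<open>y\<close>: it stays in the simplex and moves each \<open>A w i\<close> linearly
        towards \<open>a y i\<close>.\<close>
      define v where "v = (\<lambda>z. (1 - s) * w z + s * (if z = y then 1 else 0))"
      have "sum v Y = (1 - s) * sum w Y + s * (\<Sum>z\<in>Y. if z = y then 1 else 0)"
        by (simp add: v_def sum.distrib sum_distrib_left)
      with \<open>w \<in> K\<close> \<open>y \<in> Y\<close> \<open>finite Y\<close> that have "v \<in> K"
        by (auto simp: K_def v_def)
      have Av: "A v i = A w i + s * (a y i - A w i)" for i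
      proof -
        have "A v i = (\<Sum>z\<in>Y. (1 - s) * (w z * a z i) + s * (if z = y then a z i else 0))"
          unfolding A_def v_def by (intro sum.cong) (auto simp: algebra_simps)
        also have "\<dots> = (1 - s) * A w i + s * a y i"
          using \<open>y \<in> Y\<close> \<open>finite Y\<close> by (simp add: A_def sum.distrib flip: sum_distrib_left)
        finally show ?thesis by (simp add: algebra_simps)
      qed
      have "g w \<le> g v" by (rule min) fact
      also have "g v \<le> (\<Sum>i\<in>I. (res w i - s * (a y i - A w i))\<^sup>2)"
        unfolding g_def
      proof (rule sum_mono)
        fix i
        show "(res v i)\<^sup>2 \<le> (res w i - s * (a y i - A w i))\<^sup>2"
          using pos_part_diff_square_le[of "b i - A w i" "s * (a y i - A w i)"]
          by (simp add: res_def Av diff_diff_eq)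
      qed
      also have "\<dots> = (\<Sum>i\<in>I. (res w i)\<^sup>2 - 2 * s * (res w i * (a y i - A w i))
          + s\<^sup>2 * (a y i - A w i)\<^sup>2)"
        by (intro sum.cong) (auto simp: power2_eq_square algebra_simps)
      also have "\<dots> = g w - 2 * s * (\<Sum>i\<in>I. res w i * (a y i - A w i))
          + s\<^sup>2 * (\<Sum>i\<in>I. (a y i - A w i)\<^sup>2)"
        by (simp add: g_def sum.distrib sum_subtractf flip: sum_distrib_left)
      finally have "s * (2 * (\<Sum>i\<in>I. res w i * (a y i - A w i)))
          \<le> s * (s * (\<Sum>i\<in>I. (a y i - A w i)\<^sup>2))"
        by (simp add: power2_eq_square mult.assoc mult.left_commute)
      with \<open>0 < s\<close> show ?thesis by simp
    qed
    from nonpos_if_le_small_multiples[OF this] show ?thesis by simp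
  qed
  have "0 \<le> res w i" for i by (simp add: res_def)
  then obtain y where "y \<in> Y" and y: "(\<Sum>i\<in>I. res w i * b i) \<le> (\<Sum>i\<in>I. res w i * a y i)"
    using alt by blast
  \<comment> \<open>Complementarity: \<open>res w i\<close> vanishes wherever it differs from
    \<open>b i - A w i\<close>.\<close>
  have "(\<Sum>i\<in>I. (res w i)\<^sup>2) = (\<Sum>i\<in>I. res w i * (b i - A w i))"
    by (intro sum.cong) (auto simp: res_def power2_eq_square max_def)
  also have "\<dots> \<le> (\<Sum>i\<in>I. res w i * (a y i - A w i))"
    using y by (simp add: right_diff_distrib sum_subtractf)
  also have "\<dots> \<le> 0" by (rule first_order) fact
  finally have "(\<Sum>i\<in>I. (res w i)\<^sup>2) \<le> 0" .
  then have "(\<Sum>i\<in>I. (res w i)\<^sup>2) = 0"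
    by (intro antisym sum_nonneg) auto
  then have "b i \<le> A w i" if "i \<in> I" for i
    using that \<open>finite I\<close> by (auto simp: sum_nonneg_eq_0_iff res_def max_def split: if_splits)
  with \<open>w \<in> K\<close> show thesis
    by (intro that[of w]) (auto simp: K_def A_def)
qed

section \<open>The path problem and its value function\<close>

text \<open>The best value of reward minus \<open>\<beta>\<close> times length among the paths of \<open>n\<close> points that end in \<open>x\<close>
  and have their other points in \<open>S\<close>. The value 0 in the maximum allows a path to start
  late.\<close>

primrec path_value :: "('a \<Rightarrow> 'a \<Rightarrow> real) \<Rightarrow> (nat \<Rightarrow> 'a) \<Rightarrow> 'a set \<Rightarrow> (nat \<Rightarrow> real) \<Rightarrow> real \<Rightarrow> nat \<Rightarrow> 'a \<Rightarrow> real"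
  where
    "path_value d obs S \<alpha> \<beta> 0 x = 0"
  | "path_value d obs S \<alpha> \<beta> (Suc n) x = (if x = obs (Suc n) then \<alpha> (Suc n) else 0)
       + Max (insert 0 ((\<lambda>z. path_value d obs S \<alpha> \<beta> n z - \<beta> * d z x) ` S))"

declare path_value.simps(2) [simp del]

context
  fixes X S :: "'a set" and d :: "'a \<Rightarrow> 'a \<Rightarrow> real" and obs :: "nat \<Rightarrow> 'a"
    and \<alpha> :: "nat \<Rightarrow> real" and \<beta> :: real
  assumes metric: "Metric_space X d" and S: "finite S" "S \<subseteq> X"
    and \<alpha>_nonneg: "\<forall>t. 0 \<le> \<alpha> t" and \<beta>_nonneg: "0 \<le> \<beta>"
begin

interpretation Metric_space X d by (rule metric)

private abbreviation "V \<equiv> path_value d obs S \<alpha> \<beta>"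

lemma path_value_Suc_ge_step:
  assumes "z \<in> S"
  shows "(if x = obs (Suc n) then \<alpha> (Suc n) else 0) + (V n z - \<beta> * d z x) \<le> V (Suc n) x"
  using S assms by (auto intro!: Max_ge simp: path_value.simps(2))

lemma path_value_Suc_ge_reward: "(if x = obs (Suc n) then \<alpha> (Suc n) else 0) \<le> V (Suc n) x"
  using S by (auto intro!: Max_ge simp: path_value.simps(2))

lemma path_value_Suc_cases:
  obtains "V (Suc n) x = (if x = obs (Suc n) then \<alpha> (Suc n) else 0)"
  | z where "z \<in> S"
      "V (Suc n) x = (if x = obs (Suc n) then \<alpha> (Suc n) else 0) + (V n z - \<beta> * d z x)"
proof -
  let ?C = "insert 0 ((\<lambda>z. V n z - \<beta> * d z x) ` S)"
  have "Max ?C \<in> ?C" using S by (intro Max_in) auto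
  then show thesis
    using that by (fastforce simp: path_value.simps(2))
qed

lemma path_value_nonneg: "0 \<le> V n x"
proof (cases n)
  case (Suc m)
  have "0 \<le> (if x = obs (Suc m) then \<alpha> (Suc m) else 0)" using \<alpha>_nonneg by simp
  also have "\<dots> \<le> V (Suc m) x" by (rule path_value_Suc_ge_reward)
  finally show ?thesis using Suc by simp
qed simp

text \<open>Lengths only lower the value, and each reward is collected at most once. The bound makes
  the value functions integrable against probability measures.\<close>

lemma path_value_le:
  shows "V n x \<le> (\<Sum>t\<in>{1..n}. \<alpha> t)"
proof (induction n arbitrary: x)
  case (Suc n)
  have nn: "0 \<le> (\<Sum>t\<in>{1..n}. \<alpha> t)" by (intro sum_nonneg \<alpha>_nonneg[rule_format])
  show ?case
  proof (cases rule: path_value_Suc_cases[of n x])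
    case 1
    then show ?thesis using nn \<alpha>_nonneg[rule_format, of "Suc n"] by simp
  next
    case (2 z)
    have "0 \<le> \<beta> * d z x" using \<beta>_nonneg by simp
    then show ?thesis unfolding 2(2) using Suc[of z] \<alpha>_nonneg[rule_format, of "Suc n"] by auto
  qed
qed simp

text \<open>A path that ends in \<open>S\<close> may wait there for one more period at no
  cost.\<close>

lemma path_value_mono_on:
  assumes "x \<in> S"
  shows "V n x \<le> V (Suc n) x"
proof -
  have "d x x = 0" using assms S by auto
  then show ?thesis
    using path_value_Suc_ge_step[OF assms, of x n] \<alpha>_nonneg[rule_format, of "Suc n"] by (auto split: if_splits)
qed

text \<open>A point outside \<open>S\<close> collects no reward, so by the triangle inequality stopping there is no
  better than jumping directly from the last point of \<open>S\<close>.\<close>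

lemma path_value_Suc_ge:
  assumes "x \<in> X" "y \<in> X" "\<And>t. t \<in> {1..n} \<Longrightarrow> obs t \<in> S"
  shows "(if y = obs (Suc n) then \<alpha> (Suc n) else 0) + (V n x - \<beta> * d x y) \<le> V (Suc n) y"
proof (cases "x \<in> S")
  case True
  then show ?thesis by (rule path_value_Suc_ge_step)
next
  case False
  have dxy: "0 \<le> \<beta> * d x y" using \<beta>_nonneg by simp
  show ?thesis
  proof (cases n)
    case 0
    then show ?thesis using path_value_Suc_ge_reward[of y n] dxy by simp
  next
    case (Suc m)
    with False assms(3)[of n] have "x \<noteq> obs (Suc m)" by auto
    show ?thesis
    proof (cases rule: path_value_Suc_cases[of m x])
      case 1
      then show ?thesis using path_value_Suc_ge_reward[of y n] dxy Suc \<open>x \<noteq> obs (Suc m)\<close> by simp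
    next
      case (2 z)
      then have "z \<in> X" using S by auto
      \<comment> \<open>The path is rerouted: instead of visiting \<open>x\<close> it waits at
        \<open>z\<close> for one period and then jumps straight to \<open>y\<close>.\<close>
      have "V m z \<le> V n z" using path_value_mono_on[OF \<open>z \<in> S\<close>] Suc by simp
      moreover have "\<beta> * d z y \<le> \<beta> * d z x + \<beta> * d x y"
        using triangle[OF \<open>z \<in> X\<close> assms(1,2)] \<beta>_nonneg
        by (simp add: mult_left_mono flip: distrib_left)
      moreover have "V n x = V m z - \<beta> * d z x"
        using 2(2) Suc \<open>x \<noteq> obs (Suc m)\<close> by simp
      ultimately show ?thesis
        using path_value_Suc_ge_step[OF \<open>z \<in> S\<close>, of y n] by simp
    qed
  qed
qed

text \<open>Ending outside \<open>S\<close> never pays: no reward is collected there, so waiting at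
  the preceding point of \<open>S\<close> does at least as well, and a path that only starts there
  has value 0.\<close>

lemma path_value_le_on:
  assumes "\<And>t. t \<in> {1..Suc n} \<Longrightarrow> obs t \<in> S"
  shows "\<exists>z\<in>S. V (Suc n) x \<le> V (Suc n) z"
proof (cases "x \<in> S")
  case False
  with assms[of "Suc n"] have "x \<noteq> obs (Suc n)" by auto
  show ?thesis
  proof (cases rule: path_value_Suc_cases[of n x])
    case 1
    then have "V (Suc n) x \<le> V (Suc n) (obs (Suc n))"
      using path_value_nonneg[of "Suc n"] \<open>x \<noteq> obs (Suc n)\<close> by simp
    then show ?thesis using assms[of "Suc n"] by auto
  next
    case (2 z)
    have "0 \<le> \<beta> * d z x" using \<beta>_nonneg by simp
    then have "V (Suc n) x \<le> V (Suc n) z"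
      using 2 path_value_mono_on[OF \<open>z \<in> S\<close>, of n] \<open>x \<noteq> obs (Suc n)\<close> by simp
    with 2 show ?thesis by auto
  qed
qed auto

text \<open>An inequality suffices and is what the construction gives: a path that starts late is
  filled up by staying at its first point from time 1 on, which may collect rewards that the value
  ignores.\<close>

lemma path_value_attained:
  assumes "x \<in> S"
  shows "\<exists>y. (\<forall>t\<in>{1..Suc n}. y t \<in> S) \<and> y (Suc n) = x \<and>
    V (Suc n) x \<le> (\<Sum>t\<in>{1..Suc n}. if y t = obs t then \<alpha> t else 0)
      - \<beta> * (\<Sum>t\<in>{1..<Suc n}. d (y t) (y (Suc t)))"
  using assms
proof (induction n arbitrary: x)
  case 0
  have "V (Suc 0) x \<le> (if x = obs (Suc 0) then \<alpha> (Suc 0) else 0)"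
  proof (cases rule: path_value_Suc_cases[of 0 x])
    case (2 z)
    then show ?thesis using \<beta>_nonneg by auto
  qed auto
  then show ?case using 0 by (intro exI[of _ "\<lambda>_. x"]) simp
next
  case (Suc n)
  show ?case
  proof (cases rule: path_value_Suc_cases[of "Suc n" x])
    case 1
    have "(\<Sum>t\<in>{1..<Suc (Suc n)}. d x x) = 0" using S Suc.prems by (intro sum.neutral) auto
    moreover have "0 \<le> (\<Sum>t\<in>{1..Suc n}. if x = obs t then \<alpha> t else 0)"
      using \<alpha>_nonneg by (intro sum_nonneg) auto
    ultimately show ?thesis
      unfolding 1 using Suc.prems by (intro exI[of _ "\<lambda>_. x"]) simp
  next
    case (2 z)
    from Suc.IH[OF this(1)] obtain y where y: "\<forall>t\<in>{1..Suc n}. y t \<in> S" "y (Suc n) = z"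
      "V (Suc n) z \<le> (\<Sum>t\<in>{1..Suc n}. if y t = obs t then \<alpha> t else 0)
        - \<beta> * (\<Sum>t\<in>{1..<Suc n}. d (y t) (y (Suc t)))"
      by blast
    define y' where "y' = y(Suc (Suc n) := x)"
    have "(\<Sum>t\<in>{1..Suc n}. if y' t = obs t then \<alpha> t else 0)
        = (\<Sum>t\<in>{1..Suc n}. if y t = obs t then \<alpha> t else 0)"
      by (intro sum.cong) (auto simp: y'_def)
    moreover have "(\<Sum>t\<in>{1..<Suc n}. d (y' t) (y' (Suc t)))
        = (\<Sum>t\<in>{1..<Suc n}. d (y t) (y (Suc t)))"
      by (intro sum.cong) (auto simp: y'_def)
    moreover have "y' (Suc n) = z" "y' (Suc (Suc n)) = x" by (auto simp: y'_def y)
    moreover have "\<forall>t\<in>{1..Suc (Suc n)}. y' t \<in> S"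
      using y(1) Suc.prems by (auto simp: y'_def le_Suc_eq)
    ultimately show ?thesis
      unfolding 2(2) using y(3)
      by (intro exI[of _ y']) (simp add: sum.atLeastLessThan_Suc algebra_simps)
  qed
qed

end

section \<open>Measurability of the metric and of the value functions\<close>

text \<open>Lower semicontinuity makes strict superlevel sets relatively open: each is the trace on
  \<open>S\<close> of the union of all open sets on whose trace \<open>f\<close> exceeds
  \<open>a\<close>.\<close>

lemma borel_measurable_lower_semicontinuous_on:
  assumes "lower_semicontinuous_on S f"
  shows "f \<in> borel_measurable (borel_on S)"
  unfolding borel_measurable_iff_greater
proof
  fix a
  define \<U> where "\<U> = {U. open U \<and> (\<forall>x\<in>U \<inter> S. a < f x)}"
  have "\<exists>U\<in>\<U>. x \<in> U" if x: "x \<in> S" "a < f x" for x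
  proof -
    obtain U where "open U" "x \<in> U" "\<forall>y\<in>U. y \<noteq> x \<longrightarrow> y \<in> S \<longrightarrow> a < f y"
      using assms x unfolding lower_semicontinuous_on_def eventually_at_topological by blast
    with x(2) have "U \<in> \<U>" by (auto simp: \<U>_def)
    with \<open>x \<in> U\<close> show ?thesis by blast
  qed
  then have "{x \<in> space (borel_on S). a < f x} = S \<inter> \<Union>\<U>"
    by (auto simp: space_restrict_space \<U>_def)
  moreover have "open (\<Union>\<U>)"
    by (auto simp: \<U>_def)
  ultimately show "{x \<in> space (borel_on S). a < f x} \<in> sets (borel_on S)"
    by (auto simp: sets_restrict_space)
qed

text \<open>By second countability, the product of the Borel sigma-algebras is the Borel
  sigma-algebra of the product space, whose topology the semicontinuity refers to.\<close>

lemma borel_measurable_pair_lower_semicontinuous_on: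
  fixes d :: "'a::second_countable_topology \<Rightarrow> 'a \<Rightarrow> real"
  assumes "lower_semicontinuous_on (X \<times> X) (\<lambda>(x, y). d x y)"
  shows "(\<lambda>(x, y). d x y) \<in> borel_measurable (borel_on X \<Otimes>\<^sub>M borel_on X)"
proof -
  have emb: "(\<lambda>x. x) \<in> borel_on X \<rightarrow>\<^sub>M borel"
    by (intro measurable_restrict_space1) simp
  have "(\<lambda>p. (fst p, snd p)) \<in> borel_on X \<Otimes>\<^sub>M borel_on X \<rightarrow>\<^sub>M borel \<Otimes>\<^sub>M borel"
    by (intro measurable_Pair measurable_compose[OF measurable_fst emb]
        measurable_compose[OF measurable_snd emb])
  then have "(\<lambda>p. p) \<in> borel_on X \<Otimes>\<^sub>M borel_on X \<rightarrow>\<^sub>M borel_on (X \<times> X)"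
    by (intro measurable_restrict_space2) (auto simp: space_pair_measure borel_prod space_restrict_space)
  from measurable_compose[OF this borel_measurable_lower_semicontinuous_on[OF assms]]
  show ?thesis .
qed

lemma borel_measurable_path_value:
  fixes X :: "'a::t1_space set"
  assumes "finite S" and "\<And>z. z \<in> S \<Longrightarrow> d z \<in> borel_measurable (borel_on X)"
  shows "path_value d obs S \<alpha> \<beta> n \<in> borel_measurable (borel_on X)"
proof (induction n)
  case 0
  show ?case by (simp add: path_value.simps(1)[abs_def])
next
  case (Suc n)
  \<comment> \<open>The candidates in the maximum become one finite family of functions;
    \<open>None\<close> indexes the constant 0 of a late start.\<close>
  define g where "g i x = (case i of None \<Rightarrow> 0 | Some z \<Rightarrow> path_value d obs S \<alpha> \<beta> n z - \<beta> * d z x)" for i x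
  have g: "g i \<in> borel_measurable (borel_on X)" if "i \<in> insert None (Some ` S)" for i
    using that assms(2) unfolding g_def by auto
  have eq: "insert 0 ((\<lambda>z. path_value d obs S \<alpha> \<beta> n z - \<beta> * d z x) ` S)
      = (\<lambda>i. g i x) ` insert None (Some ` S)" for x
    by (auto simp: g_def image_image)
  have "{x \<in> space (borel_on X). x = obs (Suc n)} \<in> sets (borel_on X)"
    by (auto simp: sets_restrict_space space_restrict_space
        intro!: image_eqI[of _ _ "{obs (Suc n)}"])
  moreover have "(\<lambda>x. Max ((\<lambda>i. g i x) ` insert None (Some ` S))) \<in> borel_measurable (borel_on X)"
    using g assms(1) by (intro borel_measurable_Max) auto
  ultimately show ?case
    unfolding path_value.simps(2)[abs_def] eq
    by (intro borel_measurable_add measurable_If) auto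
qed

section \<open>The easy half of Kantorovich duality\<close>

lemma borel_probsD:
  assumes "P \<in> borel_probs X"
  shows "prob_space P" "sets P = sets (borel_on X)"
  using assms by (auto simp: space_prob_algebra)

lemma integrable_bounded_borel_probs:
  fixes f :: "'a::topological_space \<Rightarrow> real"
  assumes "P \<in> borel_probs X" "f \<in> borel_measurable (borel_on X)" "\<And>x. \<bar>f x\<bar> \<le> C"
  shows "integrable P f"
proof -
  interpret prob_space P using assms(1) by (rule borel_probsD)
  show ?thesis
    using assms(3) measurable_cong_sets[OF borel_probsD(2)[OF assms(1)] refl, of borel] assms(2)
    by (intro integrable_const_bound[of _ C]) auto
qed

lemma singleton_in_sets_borel_on:
  fixes x :: "'a::t1_space"
  shows "x \<in> X \<Longrightarrow> {x} \<in> sets (borel_on X)"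
  by (auto simp: sets_restrict_space intro!: image_eqI[of _ _ "{x}"])

text \<open>Integrating the pointwise bound against a coupling turns its left side into the
  difference of the two integrals and its right side into \<open>\<beta>\<close> times the cost. The
  infimum over couplings is approached up to a slack \<open>s\<close>.\<close>

lemma wasserstein_dual_bound:
  fixes d :: "'a::second_countable_topology \<Rightarrow> 'a \<Rightarrow> real"
  assumes P: "P \<in> borel_probs X" and Q: "Q \<in> borel_probs X"
    and d_meas: "(\<lambda>(x, y). d x y) \<in> borel_measurable (borel_on X \<Otimes>\<^sub>M borel_on X)"
    and d_nonneg: "\<And>x y. 0 \<le> d x y" and "0 \<le> \<beta>"
    and f: "f \<in> borel_measurable (borel_on X)" "\<And>x. \<bar>f x\<bar> \<le> C"
    and g: "g \<in> borel_measurable (borel_on X)" "\<And>x. \<bar>g x\<bar> \<le> C'"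
    and le: "\<And>x y. x \<in> X \<Longrightarrow> y \<in> X \<Longrightarrow> f x - g y \<le> \<beta> * d x y"
    and fin: "wasserstein X d P Q < \<infinity>"
  shows "(\<integral>x. f x \<partial>P) - (\<integral>y. g y \<partial>Q) \<le> \<beta> * enn2real (wasserstein X d P Q)"
proof -
  let ?W = "wasserstein X d P Q"
  have "(\<integral>x. f x \<partial>P) - (\<integral>y. g y \<partial>Q) - \<beta> * enn2real ?W \<le> s * \<beta>" if "0 < s" for s
  proof -
    \<comment> \<open>Finiteness of \<open>?W\<close> makes this strict, which is what produces a
      coupling of cost below \<open>?W + ennreal s\<close>.\<close>
    have "?W < ?W + ennreal s"
      using fin that by (cases ?W) (auto simp: ennreal_less_iff simp flip: ennreal_plus)
    then obtain \<gamma> where "\<gamma> \<in> couplings X P Q"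
      and \<gamma>_less: "(\<integral>\<^sup>+ (x, y). ennreal (d x y) \<partial>\<gamma>) < ?W + ennreal s"
      unfolding wasserstein_def INF_less_iff by blast
    from this(1) have sets_\<gamma>[measurable_cong]: "sets \<gamma> = sets (borel_on X \<Otimes>\<^sub>M borel_on X)"
      and "prob_space \<gamma>"
      and marg: "distr \<gamma> (borel_on X) fst = P" "distr \<gamma> (borel_on X) snd = Q"
      by (auto simp: couplings_def space_prob_algebra)
    interpret \<gamma>: prob_space \<gamma> by fact
    have space_\<gamma>: "space \<gamma> = X \<times> X"
      using sets_eq_imp_space_eq[OF sets_\<gamma>] by (simp add: space_pair_measure space_restrict_space)
    let ?D = "\<lambda>p. d (fst p) (snd p)"
    note d_meas' = d_meas[unfolded case_prod_beta']
    have D_meas: "?D \<in> borel_measurable \<gamma>"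
      using d_meas' by measurable
    have D_fin: "(\<integral>\<^sup>+ p. ennreal (?D p) \<partial>\<gamma>) < \<infinity>"
      using less_trans[OF \<gamma>_less[unfolded case_prod_beta'], of top] fin by simp
    have int_D: "integrable \<gamma> ?D"
      using D_meas D_fin d_nonneg by (intro integrableI_nonneg) auto
    have "(\<integral>p. ?D p \<partial>\<gamma>) = enn2real (\<integral>\<^sup>+ p. ennreal (?D p) \<partial>\<gamma>)"
      using D_meas d_nonneg by (intro integral_eq_nn_integral) auto
    also have "\<dots> \<le> enn2real (?W + ennreal s)"
      using \<gamma>_less fin by (intro enn2real_mono) (auto simp: case_prod_beta')
    also have "\<dots> = enn2real ?W + s"
      using fin that by (simp add: enn2real_plus)
    finally have D_le: "(\<integral>p. ?D p \<partial>\<gamma>) \<le> enn2real ?W + s" .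
    have fst_meas: "fst \<in> \<gamma> \<rightarrow>\<^sub>M borel_on X" and snd_meas: "snd \<in> \<gamma> \<rightarrow>\<^sub>M borel_on X"
      by measurable
    have int_f: "integrable \<gamma> (\<lambda>p. f (fst p))"
      using f(2) measurable_compose[OF fst_meas f(1)] by (intro \<gamma>.integrable_const_bound[of _ C]) auto
    have int_g: "integrable \<gamma> (\<lambda>p. g (snd p))"
      using g(2) measurable_compose[OF snd_meas g(1)] by (intro \<gamma>.integrable_const_bound[of _ C']) auto
    have "(\<integral>x. f x \<partial>P) - (\<integral>y. g y \<partial>Q) = (\<integral>p. f (fst p) - g (snd p) \<partial>\<gamma>)"
      using int_f int_g integral_distr[OF fst_meas f(1)] integral_distr[OF snd_meas g(1)]
      by (simp add: marg)
    also have "\<dots> \<le> (\<integral>p. \<beta> * ?D p \<partial>\<gamma>)"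
      using int_f int_g int_D le by (intro integral_mono) (auto simp: space_\<gamma>)
    also have "\<dots> \<le> \<beta> * (enn2real ?W + s)"
      using D_le \<open>0 \<le> \<beta>\<close> by (simp add: mult_left_mono)
    finally show ?thesis by (simp add: algebra_simps)
  qed
  from nonpos_if_le_small_multiples[OF this] show ?thesis by simp
qed

section \<open>Discrete distributions from weighted paths\<close>

text \<open>One random path with law \<open>w\<close> serves all times: \<open>Q t\<close> is the
  law of its position at time \<open>t\<close>, and the joint law of two successive positions is a
  coupling whose cost is the mean length of that step.\<close>

lemma discrete_process:
  fixes X A :: "'a::{second_countable_topology, t1_space} set" and w :: "(nat \<Rightarrow> 'a) \<Rightarrow> real"
  assumes "finite Y" "finite A" "A \<subseteq> X" and YA: "\<And>y t. y \<in> Y \<Longrightarrow> t \<in> {1..T} \<Longrightarrow> y t \<in> A"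
    and w: "\<And>y. y \<in> Y \<Longrightarrow> 0 \<le> w y" "sum w Y = 1"
    and d_meas: "(\<lambda>(x, y). d x y) \<in> borel_measurable (borel_on X \<Otimes>\<^sub>M borel_on X)"
    and d_nonneg: "\<And>x y. 0 \<le> d x y"
  obtains Q where "\<And>t. t \<in> {1..T} \<Longrightarrow> discrete_supported_on X A (Q t)"
    "\<And>t x. t \<in> {1..T} \<Longrightarrow> x \<in> X \<Longrightarrow>
      measure (Q t) {x} = (\<Sum>y\<in>Y. w y * (if y t = x then 1 else 0))"
    "\<And>t. t \<in> {1..<T} \<Longrightarrow>
      wasserstein X d (Q t) (Q (Suc t)) \<le> ennreal (\<Sum>y\<in>Y. w y * d (y t) (y (Suc t)))"
proof -
  define M where "M = point_measure Y (\<lambda>y. ennreal (w y))"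
  define Q where "Q t = distr M (borel_on X) (\<lambda>y. y t)" for t
  have prob_M: "prob_space M"
    unfolding M_def using \<open>finite Y\<close> w by (intro prob_space_point_measure) (auto simp: sum_ennreal)
  have coord: "(\<lambda>y. y t) \<in> M \<rightarrow>\<^sub>M borel_on X" if "t \<in> {1..T}" for t
    using YA[OF _ that] \<open>A \<subseteq> X\<close> by (auto simp: M_def space_restrict_space)
  have Q_probs: "Q t \<in> borel_probs X" if "t \<in> {1..T}" for t
    unfolding Q_def space_prob_algebra
    using prob_space.prob_space_distr[OF prob_M coord[OF that]] by simp
  have em_Q: "emeasure (Q t) B = (\<Sum>y\<in>Y. ennreal (w y) * indicator B (y t))"
    if "t \<in> {1..T}" "B \<in> sets (borel_on X)" for t B
  proof -
    have "emeasure (Q t) B = (\<integral>\<^sup>+ x. indicator B x \<partial>Q t)"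
      using that by (simp add: Q_def)
    also have "\<dots> = (\<integral>\<^sup>+ y. indicator B (y t) \<partial>M)"
      unfolding Q_def using that by (intro nn_integral_distr coord) auto
    also have "\<dots> = (\<Sum>y\<in>Y. ennreal (w y) * indicator B (y t))"
      unfolding M_def using \<open>finite Y\<close> by (rule nn_integral_point_measure_finite)
    finally show ?thesis .
  qed
  show thesis
  proof (rule that)
    fix t assume t: "t \<in> {1..T}"
    define v where "v x = (\<Sum>y\<in>{y\<in>Y. y t = x}. ennreal (w y))" for x
    have "emeasure (Q t) B = (\<Sum>x\<in>A. v x * emeasure (return (borel_on X) x) B)"
      if B: "B \<in> sets (borel_on X)" for B
    proof -
      have "(\<Sum>x\<in>A. v x * emeasure (return (borel_on X) x) B)
          = (\<Sum>x\<in>A. \<Sum>y\<in>{y\<in>Y. y t = x}. ennreal (w y) * indicator B (y t))"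
        using B by (intro sum.cong) (auto simp: v_def sum_distrib_right)
      \<comment> \<open>Paths are grouped by their position at time \<open>t\<close>, which lies in
        \<open>A\<close>.\<close>
      also have "\<dots> = (\<Sum>y\<in>Y. ennreal (w y) * indicator B (y t))"
        using YA[OF _ t] \<open>finite Y\<close> \<open>finite A\<close> by (intro sum.group) auto
      finally show ?thesis using em_Q[OF t B] by simp
    qed
    with Q_probs[OF t] \<open>finite A\<close> \<open>A \<subseteq> X\<close> show "discrete_supported_on X A (Q t)"
      unfolding discrete_supported_on_def by blast
    fix x assume "x \<in> X"
    have "emeasure (Q t) {x} = (\<Sum>y\<in>Y. ennreal (w y * (if y t = x then 1 else 0)))"
      unfolding em_Q[OF t singleton_in_sets_borel_on[OF \<open>x \<in> X\<close>]] by (intro sum.cong) (auto simp: indicator_def)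
    also have "\<dots> = ennreal (\<Sum>y\<in>Y. w y * (if y t = x then 1 else 0))"
      using w(1) by (intro sum_ennreal) auto
    finally have "emeasure (Q t) {x} = \<dots>" .
    then show "measure (Q t) {x} = (\<Sum>y\<in>Y. w y * (if y t = x then 1 else 0))"
      unfolding measure_def using w(1) by (simp add: sum_nonneg)
  next
    fix t assume "t \<in> {1..<T}"
    then have t: "t \<in> {1..T}" "Suc t \<in> {1..T}" by auto
    define \<gamma> where "\<gamma> = distr M (borel_on X \<Otimes>\<^sub>M borel_on X) (\<lambda>y. (y t, y (Suc t)))"
    have pair: "(\<lambda>y. (y t, y (Suc t))) \<in> M \<rightarrow>\<^sub>M borel_on X \<Otimes>\<^sub>M borel_on X"
      by (intro measurable_Pair coord t)
    have "\<gamma> \<in> couplings X (Q t) (Q (Suc t))"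
      unfolding couplings_def space_prob_algebra \<gamma>_def Q_def
      using prob_space.prob_space_distr[OF prob_M pair] pair
      by (auto simp: distr_distr comp_def)
    then have "wasserstein X d (Q t) (Q (Suc t)) \<le> (\<integral>\<^sup>+ (x, y). ennreal (d x y) \<partial>\<gamma>)"
      unfolding wasserstein_def by (rule INF_lower)
    also have "\<dots> = (\<integral>\<^sup>+ y. ennreal (d (y t) (y (Suc t))) \<partial>M)"
      unfolding \<gamma>_def using d_meas
      by (subst nn_integral_distr[OF pair]) (auto simp: case_prod_beta')
    also have "\<dots> = (\<Sum>y\<in>Y. ennreal (w y) * ennreal (d (y t) (y (Suc t))))"
      unfolding M_def using \<open>finite Y\<close> by (rule nn_integral_point_measure_finite)
    also have "\<dots> = (\<Sum>y\<in>Y. ennreal (w y * d (y t) (y (Suc t))))"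
      using w(1) d_nonneg by (intro sum.cong) (auto simp: ennreal_mult)
    also have "\<dots> = ennreal (\<Sum>y\<in>Y. w y * d (y t) (y (Suc t)))"
      using w(1) d_nonneg by (intro sum_ennreal) auto
    finally show "wasserstein X d (Q t) (Q (Suc t)) \<le> \<dots>" .
  qed
qed

lemma elog_mono: "0 \<le> p \<Longrightarrow> p \<le> q \<Longrightarrow> elog p \<le> elog q"
  by (auto simp: elog_def)

section \<open>The dual bound for paths and the existence of path weights\<close>

text \<open>Induction over the time horizon: by \<open>path_value_Suc_ge\<close>, the value at one
  time and the value at the next, less the reward there, form an admissible pair for
  \<open>wasserstein_dual_bound\<close>. The resulting inequalities telescope.\<close>

lemma path_value_integral_ge:
  fixes X :: "'a::{second_countable_topology, t1_space} set"
  assumes metric: "Metric_space X d"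
    and d_meas: "(\<lambda>(x, y). d x y) \<in> borel_measurable (borel_on X \<Otimes>\<^sub>M borel_on X)"
    and S: "finite S" "S \<subseteq> X" and \<alpha>: "\<forall>t. 0 \<le> \<alpha> t" and \<beta>: "0 \<le> \<beta>"
    and "\<And>t. t \<in> {1..Suc n} \<Longrightarrow> obs t \<in> S"
    and "\<And>t. t \<in> {1..Suc n} \<Longrightarrow> P t \<in> borel_probs X"
    and "\<And>t. t \<in> {1..<Suc n} \<Longrightarrow> wasserstein X d (P t) (P (Suc t)) < \<infinity>"
  shows "(\<Sum>t\<in>{1..Suc n}. \<alpha> t * measure (P t) {obs t})
      - \<beta> * (\<Sum>t\<in>{1..<Suc n}. enn2real (wasserstein X d (P t) (P (Suc t))))
    \<le> (\<integral>x. path_value d obs S \<alpha> \<beta> (Suc n) x \<partial>P (Suc n))"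
proof -
  note V_nonneg = path_value_nonneg[OF metric S \<alpha> \<beta>] and V_le = path_value_le[OF metric S \<alpha> \<beta>]
  have V_abs: "\<bar>path_value d obs S \<alpha> \<beta> n x\<bar> \<le> (\<Sum>t\<in>{1..n}. \<alpha> t)" for n x
    by (subst abs_of_nonneg[OF V_nonneg]) (rule V_le)
  have V_meas: "path_value d obs S \<alpha> \<beta> n \<in> borel_measurable (borel_on X)" for n
  proof (rule borel_measurable_path_value[OF \<open>finite S\<close>])
    fix z assume "z \<in> S"
    then have "z \<in> space (borel_on X)" using S by (auto simp: space_restrict_space)
    from measurable_Pair2[OF d_meas this] show "d z \<in> borel_measurable (borel_on X)" by simp
  qed
  show ?thesis
    using assms(7-)
  proof (induction n)
    case 0
    let ?P = "P (Suc 0)"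
    have "?P \<in> borel_probs X" "obs (Suc 0) \<in> X" using 0 S by auto
    interpret prob_space ?P by (rule borel_probsD) fact
    have "{obs (Suc 0)} \<in> sets ?P"
      using singleton_in_sets_borel_on[OF \<open>obs (Suc 0) \<in> X\<close>] borel_probsD(2)[OF \<open>?P \<in> borel_probs X\<close>]
      by simp
    then have "\<alpha> (Suc 0) * measure ?P {obs (Suc 0)}
        = (\<integral>x. \<alpha> (Suc 0) * indicator {obs (Suc 0)} x \<partial>?P)"
      by simp
    also have "\<dots> \<le> (\<integral>x. path_value d obs S \<alpha> \<beta> (Suc 0) x \<partial>?P)"
    proof (rule integral_mono)
      show "integrable ?P (\<lambda>x. \<alpha> (Suc 0) * indicator {obs (Suc 0)} x)"
        using \<open>{obs (Suc 0)} \<in> sets ?P\<close> by (simp add: emeasure_finite less_top[symmetric])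
      show "integrable ?P (path_value d obs S \<alpha> \<beta> (Suc 0))"
        using \<open>?P \<in> borel_probs X\<close> V_meas V_abs by (rule integrable_bounded_borel_probs)
      show "\<alpha> (Suc 0) * indicator {obs (Suc 0)} x \<le> path_value d obs S \<alpha> \<beta> (Suc 0) x" for x
        using path_value_Suc_ge_reward[OF metric S \<alpha> \<beta>, of x obs 0] by (simp add: indicator_def split: if_splits)
    qed
    finally show ?case by simp
  next
    case (Suc n)
    let ?V = "path_value d obs S \<alpha> \<beta>" and ?P = "P (Suc n)" and ?P' = "P (Suc (Suc n))"
      and ?o = "obs (Suc (Suc n))"
    \<comment> \<open>The subtracted reward integrates to the summand of the observation at the new
      time.\<close>
    let ?g = "\<lambda>x. ?V (Suc (Suc n)) x - \<alpha> (Suc (Suc n)) * indicator {?o} x"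
    have PP: "?P \<in> borel_probs X" "?P' \<in> borel_probs X" and "?o \<in> X"
      using Suc.prems S by auto
    have sing: "{?o} \<in> sets (borel_on X)"
      using \<open>?o \<in> X\<close> by (rule singleton_in_sets_borel_on)
    interpret P': prob_space ?P' by (rule borel_probsD) fact
    have int_V: "integrable ?P' (?V (Suc (Suc n)))"
      using PP(2) V_meas V_abs by (rule integrable_bounded_borel_probs)
    have int_ind: "integrable ?P' (\<lambda>x. \<alpha> (Suc (Suc n)) * indicator {?o} x)"
      using sing borel_probsD(2)[OF PP(2)] by (simp add: P'.emeasure_finite less_top[symmetric])
    have "(\<integral>x. ?V (Suc n) x \<partial>?P) - (\<integral>x. ?g x \<partial>?P')
        \<le> \<beta> * enn2real (wasserstein X d ?P ?P')"
    proof (rule wasserstein_dual_bound[OF PP d_meas _ \<beta> V_meas V_abs])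
      show "0 \<le> d x y" for x y using Metric_space.nonneg[OF metric] .
      show "?g \<in> borel_measurable (borel_on X)"
        using sing by (intro borel_measurable_diff V_meas borel_measurable_times) auto
      show "\<bar>?g x\<bar> \<le> (\<Sum>t\<in>{1..Suc (Suc n)}. \<alpha> t) + \<alpha> (Suc (Suc n))" for x
        using V_abs[of "Suc (Suc n)" x] \<alpha>[rule_format, of "Suc (Suc n)"] by (auto simp: indicator_def)
      show "?V (Suc n) x - ?g y \<le> \<beta> * d x y" if "x \<in> X" "y \<in> X" for x y
        using path_value_Suc_ge[OF metric S \<alpha> \<beta> that, of "Suc n" obs] Suc.prems(1)
        by (auto simp: indicator_def split: if_splits)
      show "wasserstein X d ?P ?P' < \<infinity>" using Suc.prems(3) by simp
    qed
    moreover have "(\<integral>x. ?g x \<partial>?P')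
        = (\<integral>x. ?V (Suc (Suc n)) x \<partial>?P') - \<alpha> (Suc (Suc n)) * measure ?P' {?o}"
      using int_V int_ind sing borel_probsD(2)[OF PP(2)] by simp
    moreover have "(\<Sum>t\<in>{1..Suc n}. \<alpha> t * measure (P t) {obs t})
        - \<beta> * (\<Sum>t\<in>{1..<Suc n}. enn2real (wasserstein X d (P t) (P (Suc t))))
        \<le> (\<integral>x. ?V (Suc n) x \<partial>?P)"
      using Suc.prems by (intro Suc.IH) auto
    ultimately show ?case
      by (simp add: algebra_simps)
  qed
qed

text \<open>The terminal value is maximal at some point of \<open>S\<close>, so its mean under
  \<open>P T\<close> is at most that maximum, and some path in \<open>S\<close> does at least as
  well.\<close>

lemma exists_path_ge:
  fixes X :: "'a::{second_countable_topology, t1_space} set"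
  assumes metric: "Metric_space X d"
    and d_meas: "(\<lambda>(x, y). d x y) \<in> borel_measurable (borel_on X \<Otimes>\<^sub>M borel_on X)"
    and S: "finite S" "S \<subseteq> X" and \<alpha>: "\<forall>t. 0 \<le> \<alpha> t" and \<beta>: "0 \<le> \<beta>" and "T > 0"
    and obs: "\<And>t. t \<in> {1..T} \<Longrightarrow> obs t \<in> S"
    and P: "\<And>t. t \<in> {1..T} \<Longrightarrow> P t \<in> borel_probs X"
    and fin: "\<And>t. t \<in> {1..<T} \<Longrightarrow> wasserstein X d (P t) (P (Suc t)) < \<infinity>"
  shows "\<exists>y\<in>{1..T} \<rightarrow>\<^sub>E S. (\<Sum>t\<in>{1..T}. \<alpha> t * measure (P t) {obs t})
      - \<beta> * (\<Sum>t\<in>{1..<T}. enn2real (wasserstein X d (P t) (P (Suc t))))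
    \<le> (\<Sum>t\<in>{1..T}. if y t = obs t then \<alpha> t else 0) - \<beta> * (\<Sum>t\<in>{1..<T}. d (y t) (y (Suc t)))"
proof -
  obtain n where T: "T = Suc n" using \<open>T > 0\<close> by (cases T) auto
  let ?V = "path_value d obs S \<alpha> \<beta> T"
  have "S \<noteq> {}" using obs[of T] T by auto
  then have "Max (?V ` S) \<in> ?V ` S"
    using \<open>finite S\<close> by simp
  then obtain z where "z \<in> S" and "?V z = Max (?V ` S)" by auto
  then have z: "?V x \<le> ?V z" if "x \<in> S" for x
    using that \<open>finite S\<close> by simp
  have V_le: "?V x \<le> ?V z" for x
    using path_value_le_on[OF metric S \<alpha> \<beta>, where obs = obs and n = n and x = x] obs z T by force
  interpret prob_space "P T" using P[of T] T by (intro borel_probsD) auto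
  have "(\<integral>x. ?V x \<partial>P T) \<le> (\<integral>x. ?V z \<partial>P T)"
  proof (cases "integrable (P T) ?V")
    case True
    then show ?thesis using V_le by (intro integral_mono) auto
  next
    \<comment> \<open>The Bochner integral of a non-integrable function is 0, and
      \<open>?V z\<close> is nonnegative.\<close>
    case False
    then show ?thesis using path_value_nonneg[OF metric S \<alpha> \<beta>] by (simp add: not_integrable_integral_eq prob_space)
  qed
  also have "\<dots> = ?V z" by (simp add: prob_space)
  finally have "(\<integral>x. ?V x \<partial>P T) \<le> ?V z" .
  moreover have "(\<Sum>t\<in>{1..T}. \<alpha> t * measure (P t) {obs t})
      - \<beta> * (\<Sum>t\<in>{1..<T}. enn2real (wasserstein X d (P t) (P (Suc t)))) \<le> (\<integral>x. ?V x \<partial>P T)"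
    unfolding T by (rule path_value_integral_ge[OF metric d_meas S \<alpha> \<beta>]) (use obs P fin T in auto)
  moreover obtain y where y: "\<forall>t\<in>{1..T}. y t \<in> S"
    "?V z \<le> (\<Sum>t\<in>{1..T}. if y t = obs t then \<alpha> t else 0) - \<beta> * (\<Sum>t\<in>{1..<T}. d (y t) (y (Suc t)))"
    using path_value_attained[OF metric S \<alpha> \<beta> \<open>z \<in> S\<close>, of n obs] T by blast
  \<comment> \<open>Restriction to the times \<open>1..T\<close> changes neither sum and puts the
    path into the finite set of extensional functions.\<close>
  moreover have "(\<Sum>t\<in>{1..T}. if restrict y {1..T} t = obs t then \<alpha> t else 0)
      = (\<Sum>t\<in>{1..T}. if y t = obs t then \<alpha> t else 0)"
    by (intro sum.cong) auto
  moreover have "(\<Sum>t\<in>{1..<T}. d (restrict y {1..T} t) (restrict y {1..T} (Suc t)))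
      = (\<Sum>t\<in>{1..<T}. d (y t) (y (Suc t)))"
    by (intro sum.cong) auto
  ultimately show ?thesis
    by (intro bexI[of _ "restrict y {1..T}"]) auto
qed

text \<open>With finite distances the weights come from \<open>finite_minimax\<close>, whose
  alternative is supplied by \<open>exists_path_ge\<close>. If some distance is infinite, the cost
  bound holds vacuously and all weight goes to the path that visits each observation at its own
  time.\<close>

lemma exists_path_weights:
  fixes X :: "'a::{second_countable_topology, t1_space} set"
  assumes metric: "Metric_space X d"
    and d_meas: "(\<lambda>(x, y). d x y) \<in> borel_measurable (borel_on X \<Otimes>\<^sub>M borel_on X)"
    and S: "finite S" "S \<subseteq> X" and "T > 0"
    and obs: "\<And>t. t \<in> {1..T} \<Longrightarrow> obs t \<in> S"
    and P: "\<And>t. t \<in> {1..T} \<Longrightarrow> P t \<in> borel_probs X"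
  obtains w where "\<And>y. y \<in> {1..T} \<rightarrow>\<^sub>E S \<Longrightarrow> 0 \<le> w y" "sum w ({1..T} \<rightarrow>\<^sub>E S) = 1"
    "\<And>t. t \<in> {1..T} \<Longrightarrow>
      measure (P t) {obs t} \<le> (\<Sum>y\<in>{1..T} \<rightarrow>\<^sub>E S. w y * (if y t = obs t then 1 else 0))"
    "(\<And>t. t \<in> {1..<T} \<Longrightarrow> wasserstein X d (P t) (P (Suc t)) < \<infinity>) \<Longrightarrow>
      (\<Sum>y\<in>{1..T} \<rightarrow>\<^sub>E S. w y * (\<Sum>t\<in>{1..<T}. d (y t) (y (Suc t))))
      \<le> (\<Sum>t\<in>{1..<T}. enn2real (wasserstein X d (P t) (P (Suc t))))"
proof (cases "\<forall>t\<in>{1..<T}. wasserstein X d (P t) (P (Suc t)) < \<infinity>")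
  case True
  let ?Y = "{1..T} \<rightarrow>\<^sub>E S"
  \<comment> \<open>Constraint 0 bounds the transport cost, constraint \<open>t \<ge> 1\<close> the mass of the \<open>t\<close>-th observation.\<close>
  define a where "a y i = (if i = 0 then - (\<Sum>t\<in>{1..<T}. d (y t) (y (Suc t)))
    else if y i = obs i then 1 else (0::real))" for y i
  define b where "b i = (if i = 0 then - (\<Sum>t\<in>{1..<T}. enn2real (wasserstein X d (P t) (P (Suc t))))
    else measure (P i) {obs i})" for i
  have split: "(\<Sum>i\<in>{0..T}. f i) = f 0 + (\<Sum>i\<in>{1..T}. f i)" for f :: "nat \<Rightarrow> real"
    by (simp add: sum.atLeast_Suc_atMost)
  have alt: "\<exists>y\<in>?Y. (\<Sum>i\<in>{0..T}. \<alpha> i * b i) \<le> (\<Sum>i\<in>{0..T}. \<alpha> i * a y i)"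
    if \<alpha>: "\<And>i. 0 \<le> \<alpha> i" for \<alpha>
  proof -
    have "(\<Sum>i\<in>{1..T}. \<alpha> i * b i) = (\<Sum>t\<in>{1..T}. \<alpha> t * measure (P t) {obs t})"
      by (intro sum.cong) (auto simp: b_def)
    moreover have "(\<Sum>i\<in>{1..T}. \<alpha> i * a y i) = (\<Sum>t\<in>{1..T}. if y t = obs t then \<alpha> t else 0)" for y
      by (intro sum.cong) (auto simp: a_def)
    \<comment> \<open>The multiplier of constraint 0 serves as the price \<open>\<beta>\<close> of
      length.\<close>
    ultimately show ?thesis
      using exists_path_ge[OF metric d_meas S, of \<alpha> "\<alpha> 0" T obs P] \<alpha> \<open>T > 0\<close> obs P True
      unfolding split by (simp add: a_def b_def)
  qed
  obtain w where w: "\<And>y. y \<in> ?Y \<Longrightarrow> 0 \<le> w y" "sum w ?Y = 1"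
    and le: "\<And>i. i \<in> {0..T} \<Longrightarrow> b i \<le> (\<Sum>y\<in>?Y. w y * a y i)"
    using finite_minimax[of ?Y "{0..T}" b a] alt finite_PiE[of "{1..T}" "\<lambda>_. S"] \<open>finite S\<close> by auto
  show thesis
  proof (rule that[OF w])
    show "measure (P t) {obs t} \<le> (\<Sum>y\<in>?Y. w y * (if y t = obs t then 1 else 0))"
      if "t \<in> {1..T}" for t
      using le[of t] that by (simp add: a_def b_def)
    show "(\<Sum>y\<in>?Y. w y * (\<Sum>t\<in>{1..<T}. d (y t) (y (Suc t))))
        \<le> (\<Sum>t\<in>{1..<T}. enn2real (wasserstein X d (P t) (P (Suc t))))"
      using le[of 0] by (simp add: a_def b_def sum_negf)
  qed
next
  case infinite: False
  let ?Y = "{1..T} \<rightarrow>\<^sub>E S"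
  have "finite ?Y" using S by (intro finite_PiE) auto
  define y0 where "y0 = restrict obs {1..T}"
  have "y0 \<in> ?Y" using obs by (auto simp: y0_def)
  show thesis
  proof (rule that[of "\<lambda>y. if y = y0 then 1 else 0"])
    fix t assume "t \<in> {1..T}"
    have "(\<Sum>y\<in>?Y. (if y = y0 then 1 else 0) * (if y t = obs t then 1 else 0))
        = (\<Sum>y\<in>?Y. if y = y0 then 1 else (0::real))"
      using \<open>t \<in> {1..T}\<close> by (intro sum.cong) (auto simp: y0_def)
    also have "\<dots> = 1" using \<open>y0 \<in> ?Y\<close> \<open>finite ?Y\<close> by simp
    finally show "measure (P t) {obs t}
        \<le> (\<Sum>y\<in>?Y. (if y = y0 then 1 else 0) * (if y t = obs t then 1 else 0))"
      using prob_space.prob_le_1[OF borel_probsD(1)[OF P[OF \<open>t \<in> {1..T}\<close>]]] by simp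
  qed (use \<open>y0 \<in> ?Y\<close> \<open>finite ?Y\<close> infinite in auto)
qed

section \<open>From path weights to an improved feasible solution\<close>

theorem proposition1:
  fixes X :: "(real ^ 'm) set"
    and d :: "real ^ 'm \<Rightarrow> real ^ 'm \<Rightarrow> real"
    and obs :: "nat \<Rightarrow> real ^ 'm"
    and T :: nat
    and lam :: real
    and P :: "nat \<Rightarrow> (real ^ 'm) measure"
  assumes "closed X"
    and "polish_metric X d"
    and "lower_semicontinuous_on (X \<times> X) (\<lambda>(x, y). d x y)"
    and "\<forall>t\<in>{1..T}. obs t \<in> X"
    and "lam \<ge> 0"
    and "wpf_feasible X T P"
  shows "\<exists>Q. wpf_feasible X T Q
    \<and> (\<forall>t\<in>{1..T}. discrete_supported_on X (obs ` {1..T}) (Q t))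
    \<and> wpf_objective X d lam T obs Q \<ge> wpf_objective X d lam T obs P"
proof (cases "T = 0")
  \<comment> \<open>All conditions range over an empty set of times, so \<open>P\<close> itself
    serves.\<close>
  case True
  then show ?thesis using assms(6) by (intro exI[of _ P]) simp
next
  case False
  let ?A = "obs ` {1..T}" and ?W = "\<lambda>P t. wasserstein X d (P t) (P (Suc t))"
  let ?Y = "{1..T} \<rightarrow>\<^sub>E ?A"
  have metric: "Metric_space X d" using assms(2) by (simp add: polish_metric_def)
  have d_nonneg: "0 \<le> d x y" for x y using Metric_space.nonneg[OF metric] .
  note d_meas = borel_measurable_pair_lower_semicontinuous_on[OF assms(3)]
  have A: "finite ?A" "?A \<subseteq> X" using assms(4) by auto
  have "finite ?Y" by (intro finite_PiE) auto
  have P: "P t \<in> borel_probs X" if "t \<in> {1..T}" for t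
    using assms(6) that by (simp add: wpf_feasible_def)
  obtain w where w: "\<And>y. y \<in> ?Y \<Longrightarrow> 0 \<le> w y" "sum w ?Y = (1::real)"
    and w_obs: "\<And>t. t \<in> {1..T} \<Longrightarrow>
      measure (P t) {obs t} \<le> (\<Sum>y\<in>?Y. w y * (if y t = obs t then 1 else 0))"
    and w_cost: "(\<And>t. t \<in> {1..<T} \<Longrightarrow> ?W P t < \<infinity>) \<Longrightarrow>
      (\<Sum>y\<in>?Y. w y * (\<Sum>t\<in>{1..<T}. d (y t) (y (Suc t)))) \<le> (\<Sum>t\<in>{1..<T}. enn2real (?W P t))"
    using exists_path_weights[OF metric d_meas A, of T obs P] \<open>T \<noteq> 0\<close> P by (auto simp: less_top)
  obtain Q where disc: "\<And>t. t \<in> {1..T} \<Longrightarrow> discrete_supported_on X ?A (Q t)"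
    and Q_obs: "\<And>t x. t \<in> {1..T} \<Longrightarrow> x \<in> X \<Longrightarrow>
      measure (Q t) {x} = (\<Sum>y\<in>?Y. w y * (if y t = x then 1 else 0))"
    and Q_W: "\<And>t. t \<in> {1..<T} \<Longrightarrow>
      ?W Q t \<le> ennreal (\<Sum>y\<in>?Y. w y * d (y t) (y (Suc t)))"
    using discrete_process[OF \<open>finite ?Y\<close> A _ w d_meas d_nonneg, of T]
    by blast
  have "wpf_feasible X T Q"
    using disc by (simp add: wpf_feasible_def discrete_supported_on_def)
  moreover have "wpf_objective X d lam T obs P \<le> wpf_objective X d lam T obs Q"
    unfolding wpf_objective_def
  \<comment> \<open>The masses of the observations are compared time by time, the transport costs
    only in total.\<close>
  proof (rule ereal_minus_mono)
    show "(\<Sum>t\<in>{1..T}. elog (measure (P t) {obs t})) \<le> (\<Sum>t\<in>{1..T}. elog (measure (Q t) {obs t}))"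
      using w_obs Q_obs assms(4) by (intro sum_mono elog_mono) auto
    show "ereal lam * (\<Sum>t\<in>{1..<T}. enn2ereal (?W Q t))
        \<le> ereal lam * (\<Sum>t\<in>{1..<T}. enn2ereal (?W P t))"
    proof (cases "\<forall>t\<in>{1..<T}. ?W P t < \<infinity>")
      case True
      define c where "c t = (\<Sum>y\<in>?Y. w y * d (y t) (y (Suc t)))" for t
      have c_nonneg: "0 \<le> c t" for t
        using w(1) d_nonneg by (auto simp: c_def intro!: sum_nonneg)
      have "(\<Sum>t\<in>{1..<T}. enn2ereal (?W Q t)) \<le> (\<Sum>t\<in>{1..<T}. ereal (c t))"
      proof (rule sum_mono)
        fix t assume "t \<in> {1..<T}"
        from Q_W[OF this] have "enn2ereal (?W Q t) \<le> enn2ereal (ennreal (c t))"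
          by (simp add: c_def less_eq_ennreal.rep_eq)
        then show "enn2ereal (?W Q t) \<le> ereal (c t)"
          using c_nonneg[of t] by (simp add: enn2ereal_ennreal)
      qed
      \<comment> \<open>The mean length of a path is the sum of the mean lengths of its
        steps.\<close>
      also have "\<dots> = ereal (\<Sum>y\<in>?Y. w y * (\<Sum>t\<in>{1..<T}. d (y t) (y (Suc t))))"
        unfolding c_def sum_distrib_left by (subst sum.swap) simp
      also have "\<dots> \<le> ereal (\<Sum>t\<in>{1..<T}. enn2real (?W P t))"
        using w_cost True by simp
      also have "\<dots> = (\<Sum>t\<in>{1..<T}. enn2ereal (?W P t))"
        unfolding sum_ereal[symmetric]
      proof (intro sum.cong refl)
        fix t assume "t \<in> {1..<T}"
        with True have "ennreal (enn2real (?W P t)) = ?W P t" by simp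
        then show "ereal (enn2real (?W P t)) = enn2ereal (?W P t)"
          by (metis enn2ereal_ennreal enn2real_nonneg)
      qed
      finally show ?thesis using assms(5) by (intro ereal_mult_left_mono) auto
    next
      case False
      then obtain s where "s \<in> {1..<T}" "?W P s = \<infinity>" by (auto simp: not_less top_unique)
      then have "(\<Sum>t\<in>{1..<T}. enn2ereal (?W P t)) = \<infinity>"
        unfolding sum_Pinfty by (auto intro!: bexI[of _ s])
      \<comment> \<open>For \<open>lam = 0\<close> both sides are 0, as
        \<open>0 * \<infinity> = 0\<close> in \<open>ereal\<close>; for \<open>lam > 0\<close> the
        right side is infinite.\<close>
      with assms(5) show ?thesis
        by (cases "lam = 0") (auto simp flip: zero_ereal_def simp del: sum_enn2ereal)
    qed
  qed
  ultimately show ?thesis using disc by blast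
qed

end
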